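(* For $n\ge 2$, the arrangement monoid $M(A_{n-1},\mathcal{H})$ has order $$|M(A_{n-1},\mathcal{H})|=(n!)^2\sum_{\lambda}\frac{1}{b_\lambda\,\lambda_1!\cdots\lambda_p!},$$ the sum being over all partitions $\lambda=(\lambda_1,\dots,\lambda_p)$ of $n$.
   Context: Let $V$ be a Euclidean space with orthonormal basis $\{x_1,\dots,x_n\}$ and $W=W(A_{n-1})$ the group generated by the orthogonal reflections in the hyperplanes $(x_i-x_j)^\perp$, $1\le i<j\le n$. Let $\mathcal{A}$ be the set of these hyperplanes and $\mathcal{H}=L(\mathcal{A})$ the set of all intersections of elements of $\mathcal{A}$, including the empty intersection $V$. The arrangement monoid is $M(A_{n-1},\mathcal{H})=\{g_X\mid g\in W,\ X\in\mathcal{H}\}$, where $g_X$ is the restriction of $g$ to $X$; it is a monoid under composition of partial maps. A partition of $n$ is a sequence of integers $\lambda_1\ge\cdots\ge\lambda_p\ge 1$ with $\sum\lambda_i=n$. If $b_i$ denotes the number of $\lambda_j$ equal to $i$, then $b_\lambda=b_1!\,b_2!\cdots(1!)^{b_1}(2!)^{b_2}\cdots$. *)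

theory Defs
  imports
    "HOL-Analysis.Analysis"
    "HOL-Algebra.Bij"
    "HOL-Algebra.Generated_Groups"
begin

definition orthonormal_basis :: "nat \<Rightarrow> (nat \<Rightarrow> 'a::euclidean_space) \<Rightarrow> bool" where
  "orthonormal_basis n x \<longleftrightarrow>
     (\<forall>i\<in>{1..n}. \<forall>j\<in>{1..n}. x i \<bullet> x j = (if i = j then 1 else 0)) \<and>
     span (x ` {1..n}) = UNIV"

text \<open>The orthogonal reflection in the hyperplane orthogonal to a nonzero vector \<open>a\<close>.\<close>

definition reflection :: "'a::euclidean_space \<Rightarrow> 'a \<Rightarrow> 'a" where
  "reflection a v = v - (2 * (v \<bullet> a) / (a \<bullet> a)) *\<^sub>R a"

definition weyl_group_A :: "nat \<Rightarrow> (nat \<Rightarrow> 'a::euclidean_space) \<Rightarrow> ('a \<Rightarrow> 'a) set" where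
  "weyl_group_A n x =
     generate (BijGroup UNIV) {reflection (x i - x j) | i j. 1 \<le> i \<and> i < j \<and> j \<le> n}"

definition arrangement_A :: "nat \<Rightarrow> (nat \<Rightarrow> 'a::euclidean_space) \<Rightarrow> 'a set set" where
  "arrangement_A n x = {orthogonal_comp {x i - x j} | i j. 1 \<le> i \<and> i < j \<and> j \<le> n}"

text \<open>All intersections of members of a family; \<open>B = {}\<close> contributes \<open>\<Inter>{} = UNIV\<close>, the whole space.\<close>

definition intersections :: "'a set set \<Rightarrow> 'a set set" where
  "intersections A = {\<Inter>B | B. B \<subseteq> A}"

text \<open>The restriction \<open>g\<^sub>X\<close> as a partial map with domain \<open>X\<close> and values in the ambient space,
  so that restrictions to different subspaces are different elements.\<close>

definition partial_restriction :: "('a \<Rightarrow> 'a) \<Rightarrow> 'a set \<Rightarrow> ('a \<rightharpoonup> 'a)" where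
  "partial_restriction g X = (\<lambda>v. Some (g v)) |` X"

text \<open>The product is composition of partial maps; the identity is the identity on the whole
  space, which is \<open>Some\<close>.\<close>

definition arrangement_monoid :: "('a \<Rightarrow> 'a) set \<Rightarrow> 'a set set \<Rightarrow> ('a \<rightharpoonup> 'a) monoid" where
  "arrangement_monoid W H =
     \<lparr>carrier = {partial_restriction g X | g X. g \<in> W \<and> X \<in> H},
      mult = (\<lambda>f g. f \<circ>\<^sub>m g),
      one = Some\<rparr>"

definition is_partition :: "nat \<Rightarrow> nat list \<Rightarrow> bool" where
  "is_partition n l \<longleftrightarrow> sorted_wrt (\<ge>) l \<and> (\<forall>k\<in>set l. 1 \<le> k) \<and> sum_list l = n"

text \<open>With \<open>b\<^sub>i = count_list l i\<close>, the product of \<open>b\<^sub>i! (i!)^(b\<^sub>i)\<close> over \<open>i \<ge> 1\<close>; for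
  \<open>i > sum_list l\<close> one has \<open>b\<^sub>i = 0\<close> and the factor is 1.\<close>

definition b_coeff :: "nat list \<Rightarrow> nat" where
  "b_coeff l =
     (\<Prod>i = 1..sum_list l. fact (count_list l i) * fact i ^ count_list l i)"

end

theory Submission
  imports Defs
begin

text \<open>
  Since the vectors \<open>x i\<close> form an orthonormal basis, the reflection in the hyperplane orthogonal to
  \<open>x i - x j\<close> exchanges two coordinates. Transpositions generate the symmetric group, so \<open>W\<close>
  consists of the coordinate permutations (\<open>weyl_group_A_eq\<close>). An intersection of hyperplanes
  forces certain coordinates to agree, so it amounts to a set partition \<open>P\<close> of \<open>{1..n}\<close>: its points are
  the vectors whose coordinates are constant on the blocks of \<open>P\<close>
  (\<open>intersections_arrangement_A_eq\<close>), and different set partitions give different subspaces.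

  Two permutations \<open>p\<close> and \<open>q\<close> have the same restriction to the subspace of \<open>P\<close> exactly when
  \<open>p ` B = q ` B\<close> for every block \<open>B\<close> (\<open>restriction_eq_iff_block_images_eq\<close>), that is, when they lie
  in the same left coset of the stabilizer of the blocks. This stabilizer is a product of
  symmetric groups, so \<open>P\<close> contributes \<open>n!\<close> divided by the product of the \<open>\<bar>B\<bar>!\<close> elements. A
  partial map determines its domain and hence \<open>P\<close>, so the order of the monoid is the sum of these
  contributions over all set partitions (\<open>order_arrangement_monoid_A\<close>).

  The contribution of \<open>P\<close> depends only on its type, the multiset of its block sizes, which is an
  integer partition \<open>\<lambda>\<close>. There are \<open>n! / b\<^sub>\<lambda>\<close> set partitions of type \<open>\<lambda>\<close>
  (\<open>card_partitions_of_type\<close>), and grouping the sum by type gives the formula.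
\<close>

section \<open>Counting permutations modulo a set partition\<close>

lemma card_image_uniform_fibres:
  assumes "finite S" and "\<And>y. y \<in> S \<Longrightarrow> card {z \<in> S. f z = f y} = k"
  shows "card (f ` S) * k = card S"
proof -
  have "card S = (\<Sum>c\<in>f ` S. card {z \<in> S. f z = c})"
    using sum.image_gen[OF assms(1), of "\<lambda>_. 1::nat" f] by simp
  also have "\<dots> = (\<Sum>c\<in>f ` S. k)"
    using assms(2) by (intro sum.cong) auto
  finally show ?thesis by simp
qed

text \<open>The stabilizer is the product of the symmetric groups of the blocks: a permutation in it is
  glued together from arbitrary permutations of the individual blocks.\<close>

lemma card_block_stabilizer:
  assumes fin: "finite A" and P: "partition_on A P"
  shows "card {s. s permutes A \<and> (\<forall>B\<in>P. s ` B = B)} = (\<Prod>B\<in>P. fact (card B))"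
proof -
  let ?S = "{s. s permutes A \<and> (\<forall>B\<in>P. s ` B = B)}"
  let ?T = "\<Pi>\<^sub>E B\<in>P. {t. t permutes B}"
  let ?F = "\<lambda>s. \<lambda>B\<in>P. \<lambda>i. if i \<in> B then s i else i"
  have UP: "\<Union>P = A" and disj: "\<And>B C i. B \<in> P \<Longrightarrow> C \<in> P \<Longrightarrow> i \<in> B \<Longrightarrow> i \<in> C \<Longrightarrow> B = C"
    using P by (auto simp: partition_on_def disjoint_def)
  have finP: "finite P" using fin P by (rule finite_elements)
  have finB: "finite B" if "B \<in> P" for B
    using that UP fin by (meson Union_upper finite_subset)
  have "bij_betw ?F ?S ?T"
  proof (rule bij_betw_imageI)
    show "inj_on ?F ?S"
    proof (rule inj_onI, rule ext)
      fix s t i assume s: "s \<in> ?S" and t: "t \<in> ?S" and eq: "?F s = ?F t"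
      show "s i = t i"
      proof (cases "i \<in> A")
        case True
        then obtain B where B: "B \<in> P" "i \<in> B" using UP by auto
        then show ?thesis using fun_cong[OF fun_cong[OF eq, of B], of i] by simp
      next
        case False
        then show ?thesis using s t by (auto simp: permutes_not_in)
      qed
    qed
    show "?F ` ?S = ?T"
    proof (intro equalityI subsetI)
      fix f assume "f \<in> ?F ` ?S"
      then obtain s where s: "s \<in> ?S" and f: "f = ?F s" by blast
      have "(\<lambda>i. if i \<in> B then s i else i) permutes B" if "B \<in> P" for B
      proof (rule bij_imp_permutes)
        have "bij_betw s B B"
          using s that by (auto simp: bij_betw_def intro: inj_on_subset[OF permutes_inj])
        then show "bij_betw (\<lambda>i. if i \<in> B then s i else i) B B"
          by (rule bij_betw_cong[THEN iffD1, rotated]) simp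
      qed auto
      then show "f \<in> ?T" unfolding f by auto
    next
      fix f assume f: "f \<in> ?T"
      \<comment> \<open>The description operator picks the unique block containing \<open>i\<close>.\<close>
      define s where "s i = (if i \<in> A then f (THE B. B \<in> P \<and> i \<in> B) i else i)" for i
      have sB: "s i = f B i" if "B \<in> P" "i \<in> B" for B i
      proof -
        have "(THE C. C \<in> P \<and> i \<in> C) = B" using that disj by (intro the_equality) auto
        then show ?thesis using that UP by (auto simp: s_def)
      qed
      have fB: "f B permutes B" if "B \<in> P" for B using f that by auto
      have imB: "s ` B = B" if "B \<in> P" for B
        using permutes_image[OF fB[OF that]] sB[OF that] by (metis image_cong)
      have "bij_betw s A A"
      proof (rule bij_betw_imageI)
        show "inj_on s A"
        proof (rule inj_onI)
          fix i j assume ij: "i \<in> A" "j \<in> A" and eq: "s i = s j"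
          obtain B C where BC: "B \<in> P" "i \<in> B" "C \<in> P" "j \<in> C" using ij UP by auto
          have "s i \<in> B" "s j \<in> C" using BC imB by auto
          then have "B = C" using BC disj eq by metis
          then have "f B i = f B j" using sB BC eq by metis
          then show "i = j" using permutes_inj[OF fB[OF BC(1)]] by (auto dest: injD)
        qed
        show "s ` A = A" using imB unfolding UP[symmetric] by (auto simp: image_Union)
      qed
      then have "s permutes A" by (rule bij_imp_permutes) (simp add: s_def)
      then have "s \<in> ?S" using imB by simp
      moreover have "f = ?F s"
      proof (intro ext)
        fix B i
        show "f B i = ?F s B i"
        proof (cases "B \<in> P")
          case True
          then show ?thesis using sB fB[OF True] by (simp add: permutes_not_in)
        next
          case False
          then have "f B = undefined" using f by (rule PiE_arb[rotated])
          then show ?thesis using False by simp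
        qed
      qed
      ultimately show "f \<in> ?F ` ?S" by blast
    qed
  qed
  then have "card ?S = card ?T" by (rule bij_betw_same_card)
  also have "\<dots> = (\<Prod>B\<in>P. card {t. t permutes B})" using finP by (rule card_PiE)
  also have "\<dots> = (\<Prod>B\<in>P. fact (card B))"
    using finB by (intro prod.cong) (auto intro: card_permutations)
  finally show ?thesis .
qed

text \<open>Lagrange's theorem for the stabilizer: the fibre of \<open>F\<close> through \<open>p\<close> is the left coset of \<open>p\<close>.
  The map \<open>F\<close> is left abstract so that restriction of linear maps can take its place.\<close>

lemma card_permutations_mod_blocks:
  assumes fin: "finite A" and P: "partition_on A P"
    and F: "\<And>p q. p permutes A \<Longrightarrow> q permutes A \<Longrightarrow> F p = F q \<longleftrightarrow> (\<forall>B\<in>P. p ` B = q ` B)"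
  shows "card (F ` {p. p permutes A}) * (\<Prod>B\<in>P. fact (card B)) = fact (card A)"
proof -
  have "card {q \<in> {p. p permutes A}. F q = F p} = (\<Prod>B\<in>P. fact (card B))"
    if "p \<in> {p. p permutes A}" for p
  proof -
    let ?S = "{s. s permutes A \<and> (\<forall>B\<in>P. s ` B = B)}"
    have p: "p permutes A" using that by simp
    have "{q \<in> {p. p permutes A}. F q = F p} = (\<lambda>s. p \<circ> s) ` ?S"
    proof (intro equalityI subsetI)
      fix q assume "q \<in> {q \<in> {p. p permutes A}. F q = F p}"
      then have q: "q permutes A" and im: "\<forall>B\<in>P. q ` B = p ` B"
        using F[of q p] p by auto
      let ?s = "inv_into UNIV p \<circ> q"
      have "?s permutes A" using p q by (intro permutes_compose permutes_inv)
      moreover have "?s ` B = B" if "B \<in> P" for B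
        using that im permutes_inj[OF p] by (metis image_comp image_inv_f_f)
      moreover have "q = p \<circ> ?s" using permutes_surj[OF p] by (auto simp: fun_eq_iff surj_f_inv_f)
      ultimately show "q \<in> (\<lambda>s. p \<circ> s) ` ?S" by blast
    next
      fix q assume "q \<in> (\<lambda>s. p \<circ> s) ` ?S"
      then obtain s where s: "s permutes A" "\<forall>B\<in>P. s ` B = B" and q: "q = p \<circ> s" by auto
      have "q permutes A" unfolding q using s(1) p by (rule permutes_compose)
      moreover have im: "\<forall>B\<in>P. q ` B = p ` B" using s(2) unfolding q by (metis image_comp)
      ultimately show "q \<in> {q \<in> {p. p permutes A}. F q = F p}"
        using F[of q p] p im by simp
    qed
    moreover have "inj_on (\<lambda>s. p \<circ> s) ?S"
      using permutes_inj[OF p] by (auto intro!: inj_onI simp: fun_eq_iff inj_eq)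
    ultimately show ?thesis
      using card_block_stabilizer[OF fin P] by (simp add: card_image)
  qed
  then have "card (F ` {p. p permutes A}) * (\<Prod>B\<in>P. fact (card B)) = card {p. p permutes A}"
    by (rule card_image_uniform_fibres[OF finite_permutations[OF fin]])
  then show ?thesis by (simp add: card_permutations[OF refl fin])
qed

section \<open>Counting set partitions of a given type\<close>

definition block_sizes :: "'a set set \<Rightarrow> nat multiset" where
  "block_sizes P = image_mset card (mset_set P)"

text \<open>The number \<open>b\<^sub>\<lambda>\<close> for \<open>\<lambda>\<close> given as a multiset. The upper bound of the product is a separate
  parameter so that it can stay fixed while parts are added to the multiset; parts of
  multiplicity 0 contribute a factor 1.\<close>

definition type_weight :: "nat \<Rightarrow> nat multiset \<Rightarrow> nat" where
  "type_weight m M = (\<Prod>i = 1..m. fact (count M i) * fact i ^ count M i)"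

lemma type_weight_add_mset:
  assumes "1 \<le> k" "k \<le> m"
  shows "type_weight m (add_mset k M) = Suc (count M k) * fact k * type_weight m M"
proof -
  have "type_weight m N = fact (count N k) * fact k ^ count N k *
      (\<Prod>i\<in>{1..m} - {k}. fact (count N i) * fact i ^ count N i)" for N
    unfolding type_weight_def using assms by (subst prod.remove[of _ k]) auto
  from this[of M] this[of "add_mset k M"] show ?thesis by (simp add: algebra_simps)
qed

lemma count_block_sizes:
  assumes "finite P"
  shows "count (block_sizes P) k = card {B \<in> P. card B = k}"
proof -
  have "count (block_sizes P) k = (\<Sum>B | B \<in> P \<and> k = card B. count (mset_set P) B)"
    using assms unfolding block_sizes_def by (simp add: count_image_mset')
  also have "\<dots> = (\<Sum>B | B \<in> P \<and> k = card B. 1)"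
    using assms by (intro sum.cong) auto
  also have "\<dots> = card {B \<in> P. card B = k}"
    by (simp add: eq_commute)
  finally show ?thesis .
qed

text \<open>
  Induction on the type, by double counting: consider the pairs \<open>(P, B)\<close> of a set partition \<open>P\<close> of
  \<open>A\<close> with type \<open>M + {k}\<close> and a block \<open>B\<close> of \<open>P\<close> of size \<open>k\<close>. Each \<open>P\<close> occurs as often as \<open>k\<close> occurs
  in its type. On the other hand, such a pair is the choice of a \<open>k\<close>-element subset \<open>B\<close> and of a set
  partition of \<open>A - B\<close> of type \<open>M\<close>. Writing \<open>N\<close> for the number of set partitions of a given type,
  this reads \<open>N (M + {k}) * (count M k + 1) = (\<bar>A\<bar> choose k) * N M\<close>, and the weight changes by
  exactly the matching factor.
\<close>

lemma card_partitions_of_type: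
  assumes "finite A" "set_mset M \<subseteq> {1..m}" "sum_mset M = card A"
  shows "card {P. partition_on A P \<and> block_sizes P = M} * type_weight m M = fact (card A)"
  using assms
proof (induction M arbitrary: A)
  case empty
  then have "A = {}" by simp
  then have "{P. partition_on A P \<and> block_sizes P = {#}} = {{}}"
    by (auto simp: partition_on_empty block_sizes_def)
  then show ?case using \<open>A = {}\<close> by (simp only: type_weight_def) simp
next
  case (add k M)
  let ?Q = "\<lambda>A M. {P. partition_on A P \<and> block_sizes P = M}"
  have k: "1 \<le> k" "k \<le> m" and cA: "card A = k + sum_mset M" using add.prems by auto
  have fin: "finite (?Q C N)" if "finite C" for C :: "'a set" and N
    using finitely_many_partition_on[OF that] by (rule rev_finite_subset) auto
  let ?L = "SIGMA P : ?Q A (add_mset k M). {B \<in> P. card B = k}"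
  let ?R = "SIGMA B : {B. B \<subseteq> A \<and> card B = k}. ?Q (A - B) M"
  have "bij_betw (\<lambda>(P, B). (B, P - {B})) ?L ?R"
  proof (rule bij_betw_byWitness[where f' = "\<lambda>(B, P). (insert B P, B)"])
    show "(\<lambda>(P, B). (B, P - {B})) ` ?L \<subseteq> ?R"
    proof clarsimp
      fix P B assume P: "partition_on A P" "block_sizes P = add_mset (card B) M" "B \<in> P"
         and k: "k = card B"
      have finP: "finite P" using add.prems(1) P(1) by (rule finite_elements)
      have "block_sizes P = add_mset (card B) (block_sizes (P - {B}))"
        using finP P(3) unfolding block_sizes_def
        by (simp add: mset_set.remove)
      moreover have "partition_on (A - B) (P - {B})"
        using P(1,3) by (auto simp: partition_on_def disjoint_def)
      moreover have "B \<subseteq> A" using P by (auto simp: partition_on_def)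
      ultimately show "B \<subseteq> A \<and> partition_on (A - B) (P - {B}) \<and> block_sizes (P - {B}) = M"
        using P(2) by simp
    qed
    show "(\<lambda>(B, P). (insert B P, B)) ` ?R \<subseteq> ?L"
    proof clarsimp
      fix P B assume B: "B \<subseteq> A" "k = card B" and P: "partition_on (A - B) P" "M = block_sizes P"
      have ne: "B \<noteq> {}" using B k by auto
      have "finite P" using add.prems(1) P(1) finite_elements by blast
      moreover have "B \<notin> P" using P(1) ne by (auto simp: partition_on_def)
      ultimately have "block_sizes (insert B P) = add_mset (card B) (block_sizes P)"
        by (simp add: block_sizes_def)
      moreover have "partition_on A (insert B P)"
        using P(1) B(1) ne by (auto simp: partition_on_def disjoint_def)
      ultimately show "partition_on A (insert B P) \<and> block_sizes (insert B P) = add_mset (card B) (block_sizes P)"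
        by simp
    qed
    show "\<forall>a\<in>?L. (\<lambda>(B, P). (insert B P, B)) ((\<lambda>(P, B). (B, P - {B})) a) = a" by auto
    show "\<forall>a\<in>?R. (\<lambda>(P, B). (B, P - {B})) ((\<lambda>(B, P). (insert B P, B)) a) = a"
    proof clarsimp
      fix P B assume "B \<subseteq> A" "k = card B" "partition_on (A - B) P"
      moreover have "B \<noteq> {}" using calculation k by auto
      ultimately have "B \<notin> P" by (auto simp: partition_on_def)
      then show "P - {B} = P" by simp
    qed
  qed
  then have "card ?L = card ?R" by (rule bij_betw_same_card)
  moreover have "card ?L = card (?Q A (add_mset k M)) * Suc (count M k)"
  proof -
    have "card {B \<in> P. card B = k} = Suc (count M k)" if "P \<in> ?Q A (add_mset k M)" for P
      using that count_block_sizes[of P k] finite_elements[OF add.prems(1)] by auto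
    moreover have "finite P" if "P \<in> ?Q A (add_mset k M)" for P
      using that finite_elements[OF add.prems(1)] by auto
    ultimately show ?thesis
      using fin[OF add.prems(1)] by (subst card_SigmaI) auto
  qed
  moreover have "card ?R * type_weight m M = (card A choose k) * fact (card A - k)"
  proof -
    have "card (?Q (A - B) M) * type_weight m M = fact (card A - k)"
      if "B \<in> {B. B \<subseteq> A \<and> card B = k}" for B
    proof -
      have "card (A - B) = card A - k"
        using that add.prems(1) by (auto simp: card_Diff_subset finite_subset)
      then show ?thesis using add.IH[of "A - B"] add.prems(1,2) cA by auto
    qed
    moreover have "card ?R = (\<Sum>B | B \<subseteq> A \<and> card B = k. card (?Q (A - B) M))"
      using add.prems(1) fin by (subst card_SigmaI) auto
    ultimately show ?thesis
      using n_subsets[OF add.prems(1), of k] by (simp add: sum_distrib_right)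
  qed
  moreover have "card (?Q A (add_mset k M)) * type_weight m (add_mset k M)
      = card (?Q A (add_mset k M)) * Suc (count M k) * type_weight m M * fact k"
    using type_weight_add_mset[OF k, of M] by (simp only: ac_simps)
  ultimately have "card (?Q A (add_mset k M)) * type_weight m (add_mset k M)
      = fact k * fact (card A - k) * (card A choose k)"
    by (simp only: ac_simps)
  also have "\<dots> = fact (card A)" using cA by (intro binomial_fact_lemma) simp
  finally show ?case .
qed


lemma block_sizes_of_partition:
  assumes fin: "finite A" and P: "partition_on A P"
  shows "set_mset (block_sizes P) \<subseteq> {1..card A}" and "sum_mset (block_sizes P) = card A"
proof -
  have finP: "finite P" using fin P by (rule finite_elements)
  have sub: "B \<subseteq> A" "B \<noteq> {}" if "B \<in> P" for B using P that by (auto simp: partition_on_def)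
  then have finB: "finite B" if "B \<in> P" for B using that fin finite_subset by blast
  show "set_mset (block_sizes P) \<subseteq> {1..card A}"
    using finP sub finB fin by (fastforce simp: block_sizes_def Suc_le_eq card_gt_0_iff intro!: card_mono)
  have "card (\<Union>P) = sum card P"
    using P finB by (intro card_Union_disjoint) (auto simp: partition_on_def disjoint_def pairwise_def disjnt_def)
  then show "sum_mset (block_sizes P) = card A"
    using P by (simp add: block_sizes_def sum_unfold_sum_mset partition_on_def)
qed

lemma finite_is_partition: "finite {l. is_partition n l}"
proof (rule finite_subset)
  show "finite {l. set l \<subseteq> {1..n} \<and> length l \<le> n}"
    by (rule finite_lists_length_le) simp
  have "length l \<le> sum_list l" if "\<forall>k\<in>set l. 1 \<le> k" for l :: "nat list"
    using that by (induction l) auto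
  then show "{l. is_partition n l} \<subseteq> {l. set l \<subseteq> {1..n} \<and> length l \<le> n}"
    by (auto simp: is_partition_def intro: member_le_sum_list)
qed

text \<open>A weakly decreasing list is recovered from its multiset by sorting, so integer partitions are
  canonical representatives of types.\<close>

lemma is_partition_eq_iff:
  assumes "is_partition n l"
  shows "rev (sorted_list_of_multiset M) = l \<longleftrightarrow> M = mset l"
proof
  assume "M = mset l"
  moreover have "sorted (rev l)" using assms by (simp add: is_partition_def sorted_wrt_rev)
  ultimately show "rev (sorted_list_of_multiset M) = l"
    by (metis mset_rev rev_rev_ident sorted_list_of_multiset_mset sorted_sort_id)
qed (metis mset_rev mset_sorted_list_of_multiset)

lemma sum_over_set_partitions_by_type:
  fixes f :: "nat multiset \<Rightarrow> real"
  assumes fin: "finite A"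
  shows "(\<Sum>P | partition_on A P. f (block_sizes P)) =
    (\<Sum>l | is_partition (card A) l. real (card {P. partition_on A P \<and> block_sizes P = mset l}) * f (mset l))"
proof -
  let ?S = "{P. partition_on A P}" and ?T = "{l. is_partition (card A) l}"
  let ?g = "\<lambda>P. rev (sorted_list_of_multiset (block_sizes P))"
  have "?g ` ?S \<subseteq> ?T"
  proof clarsimp
    fix P assume P: "partition_on A P"
    have "mset (?g P) = block_sizes P" by simp
    then have "sum_list (?g P) = card A"
      using block_sizes_of_partition(2)[OF fin P] by (metis sum_mset_sum_list)
    moreover have "\<forall>k\<in>set (?g P). 1 \<le> k"
      using block_sizes_of_partition(1)[OF fin P] by auto
    moreover have "sorted_wrt (\<ge>) (?g P)"
      by (simp add: sorted_wrt_rev)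
    ultimately show "is_partition (card A) (?g P)"
      by (simp add: is_partition_def)
  qed
  then have "(\<Sum>P\<in>?S. f (block_sizes P)) = (\<Sum>l\<in>?T. \<Sum>P | P \<in> ?S \<and> ?g P = l. f (block_sizes P))"
    using finitely_many_partition_on[OF fin] finite_is_partition by (intro sum.group[symmetric]) auto
  also have "\<dots> = (\<Sum>l\<in>?T. \<Sum>P | partition_on A P \<and> block_sizes P = mset l. f (mset l))"
    by (intro sum.cong) (auto simp: is_partition_eq_iff)
  finally show ?thesis by simp
qed

lemma b_coeff_eq_type_weight:
  assumes "is_partition n l"
  shows "b_coeff l = type_weight n (mset l)"
  using assms by (simp add: b_coeff_def type_weight_def is_partition_def count_mset)

section \<open>The Weyl group as permutations of coordinates\<close>

text \<open>The linear map that sends each basis vector \<open>x i\<close> to \<open>x (p i)\<close>.\<close>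

definition permute_coordinates :: "nat \<Rightarrow> (nat \<Rightarrow> 'a::euclidean_space) \<Rightarrow> (nat \<Rightarrow> nat) \<Rightarrow> 'a \<Rightarrow> 'a" where
  "permute_coordinates n x p v = (\<Sum>i = 1..n. (v \<bullet> x i) *\<^sub>R x (p i))"

context
  fixes n :: nat and x :: "nat \<Rightarrow> 'a::euclidean_space"
  assumes onb: "orthonormal_basis n x"
begin

abbreviation "L \<equiv> permute_coordinates n x"

lemma inner_basis: "i \<in> {1..n} \<Longrightarrow> j \<in> {1..n} \<Longrightarrow> x i \<bullet> x j = (if i = j then 1 else 0)"
  using onb by (simp add: orthonormal_basis_def)

lemma eq_if_coordinates_eq:
  assumes "\<And>i. i \<in> {1..n} \<Longrightarrow> v \<bullet> x i = w \<bullet> x i"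
  shows "v = w"
proof -
  have "v - w \<in> span (x ` {1..n})" using onb by (simp add: orthonormal_basis_def)
  then have "orthogonal (v - w) (v - w)"
    by (rule orthogonal_to_span) (use assms in \<open>auto simp: orthogonal_def inner_diff_left\<close>)
  then show ?thesis by (simp add: orthogonal_def)
qed

lemma inner_permute_coordinates:
  assumes p: "p permutes {1..n}" and i: "i \<in> {1..n}"
  shows "L p v \<bullet> x (p i) = v \<bullet> x i"
proof -
  have "L p v \<bullet> x (p i) = (\<Sum>j = 1..n. (v \<bullet> x j) * (x (p j) \<bullet> x (p i)))"
    by (simp add: permute_coordinates_def inner_sum_left)
  also have "\<dots> = (\<Sum>j = 1..n. if i = j then v \<bullet> x j else 0)"
    using permutes_inj[OF p] permutes_in_image[OF p] i
    by (intro sum.cong) (auto simp: inner_basis inj_eq)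
  also have "\<dots> = v \<bullet> x i" using i by simp
  finally show ?thesis .
qed

text \<open>This characterization by coordinates reduces every identity between the maps \<open>L p\<close> to one
  between inner products, and it avoids inverse permutations.\<close>

lemma permute_coordinates_eq_iff:
  assumes p: "p permutes {1..n}"
  shows "L p v = w \<longleftrightarrow> (\<forall>i\<in>{1..n}. w \<bullet> x (p i) = v \<bullet> x i)"
proof
  assume R: "\<forall>i\<in>{1..n}. w \<bullet> x (p i) = v \<bullet> x i"
  show "L p v = w"
  proof (rule eq_if_coordinates_eq)
    fix j assume "j \<in> {1..n}"
    then obtain i where "i \<in> {1..n}" "j = p i" using permutes_image[OF p] by blast
    then show "L p v \<bullet> x j = w \<bullet> x j" using R inner_permute_coordinates[OF p] by simp
  qed
qed (auto simp: inner_permute_coordinates[OF p])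

lemma permute_coordinates_id: "L id = id"
  by (rule ext) (simp add: permute_coordinates_eq_iff permutes_id)

lemma permute_coordinates_comp:
  assumes p: "p permutes {1..n}" and q: "q permutes {1..n}"
  shows "L (p \<circ> q) = L p \<circ> L q"
proof (rule ext)
  fix v
  have "L p (L q v) \<bullet> x (p (q i)) = v \<bullet> x i" if "i \<in> {1..n}" for i
    using that permutes_in_image[OF q, of i] inner_permute_coordinates[OF p, of "q i"]
      inner_permute_coordinates[OF q] by simp
  then show "L (p \<circ> q) v = (L p \<circ> L q) v"
    by (simp add: permute_coordinates_eq_iff[OF permutes_compose[OF q p]])
qed

lemma permute_coordinates_inverse:
  assumes p: "p permutes {1..n}"
  shows "L (inv_into UNIV p) \<circ> L p = id" "L p \<circ> L (inv_into UNIV p) = id"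
  using permute_coordinates_comp[OF p permutes_inv[OF p]] permute_coordinates_comp[OF permutes_inv[OF p] p]
  by (simp_all add: permutes_inv_o[OF p] permute_coordinates_id)

lemma reflection_eq_permute_coordinates:
  assumes i: "i \<in> {1..n}" and j: "j \<in> {1..n}" and ne: "i \<noteq> j"
  shows "reflection (x i - x j) = L (Transposition.transpose i j)"
proof (rule ext, rule sym)
  fix v
  have "(x i - x j) \<bullet> (x i - x j) = 2"
    using i j ne by (simp add: inner_diff_left inner_diff_right inner_basis)
  then have r: "reflection (x i - x j) v = v - (v \<bullet> x i - v \<bullet> x j) *\<^sub>R (x i - x j)"
    by (simp add: reflection_def inner_diff_right)
  have "reflection (x i - x j) v \<bullet> x (Transposition.transpose i j k) = v \<bullet> x k" if k: "k \<in> {1..n}" for k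
    using i j k ne unfolding r Transposition.transpose_def
    by (auto simp: inner_diff_left inner_basis)
  then show "L (Transposition.transpose i j) v = reflection (x i - x j) v"
    using permutes_swap_id[OF i j] by (simp add: permute_coordinates_eq_iff)
qed

lemma weyl_group_A_eq: "weyl_group_A n x = L ` {p. p permutes {1..n}}"
proof -
  let ?G = "BijGroup (UNIV :: 'a set)"
  let ?E = "L ` {p. p permutes {1..n}}"
  interpret G: group ?G by (rule group_BijGroup)
  have Bij: "L p \<in> Bij UNIV" if "p permutes {1..n}" for p
    using o_bij[OF permute_coordinates_inverse[OF that]] by (simp add: Bij_def)
  have mult: "mult ?G (L p) (L q) = L (p \<circ> q)" if "p permutes {1..n}" "q permutes {1..n}" for p q
    using Bij[OF that(1)] Bij[OF that(2)] permute_coordinates_comp[OF that]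
    by (simp add: BijGroup_def compose_def comp_def restrict_UNIV)
  have one: "one ?G = L id" unfolding permute_coordinates_id by (auto simp: BijGroup_def)
  have carrier: "?E \<subseteq> carrier ?G" using Bij by (auto simp: BijGroup_def)
  have "?E = generate ?G {reflection (x i - x j) | i j. 1 \<le> i \<and> i < j \<and> j \<le> n}"
  proof (rule G.generateI)
    show "subgroup ?E ?G"
    proof (rule G.subgroupI)
      show "?E \<noteq> {}" using permutes_id by blast
      fix g assume "g \<in> ?E"
      then obtain p where p: "p permutes {1..n}" and g: "g = L p" by blast
      have "m_inv ?G g = L (inv_into UNIV p)"
      proof (rule G.inv_equality)
        show "mult ?G (L (inv_into UNIV p)) g = one ?G"
          unfolding g one mult[OF permutes_inv[OF p] p] permutes_inv_o(2)[OF p] ..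
      qed (use carrier p permutes_inv[OF p] g in auto)
      then show "m_inv ?G g \<in> ?E" using permutes_inv[OF p] by blast
    next
      fix g h assume "g \<in> ?E" "h \<in> ?E"
      then obtain p q where p: "p permutes {1..n}" "g = L p" and q: "q permutes {1..n}" "h = L q"
        by blast
      then show "mult ?G g h \<in> ?E" using mult[OF p(1) q(1)] permutes_compose[OF q(1) p(1)] by simp
    qed (rule carrier)
    show "{reflection (x i - x j) | i j. 1 \<le> i \<and> i < j \<and> j \<le> n} \<subseteq> ?E"
    proof clarify
      fix i j :: nat assume "1 \<le> i" "i < j" "j \<le> n"
      then have ij: "i \<in> {1..n}" "j \<in> {1..n}" "i \<noteq> j" by auto
      then show "reflection (x i - x j) \<in> ?E"
        using permutes_swap_id[OF ij(1,2)] by (auto simp: reflection_eq_permute_coordinates)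
    qed
  next
    fix K assume K: "subgroup K ?G"
      and gens: "{reflection (x i - x j) | i j. 1 \<le> i \<and> i < j \<and> j \<le> n} \<subseteq> K"
    have transp: "L (Transposition.transpose i j) \<in> K" if "i \<in> {1..n}" "j \<in> {1..n}" "i < j" for i j
    proof -
      have "reflection (x i - x j) \<in> K" using gens that by auto
      then show ?thesis using that by (simp add: reflection_eq_permute_coordinates)
    qed
    have "L p \<in> K" if "p permutes {1..n}" for p
      using that finite_atLeastAtMost
    proof (induction p rule: permutes_induct)
      case id
      show ?case using subgroup.one_closed[OF K] unfolding one .
    next
      case (swap a b p)
      have "L (Transposition.transpose a b) \<in> K"
      proof (cases "a < b")
        case True
        then show ?thesis using transp swap by blast
      next
        case False
        then have "b < a" using swap by simp
        then show ?thesis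
          using transp[of b a] swap by (simp add: transpose_commute)
      qed
      then have "mult ?G (L (Transposition.transpose a b)) (L p) \<in> K"
        using swap by (intro subgroup.m_closed[OF K])
      then show ?case using mult[OF permutes_swap_id[of a _ b]] swap by metis
    qed
    then show "?E \<subseteq> K" by blast
  qed
  then show ?thesis by (simp add: weyl_group_A_def)
qed


section \<open>Intersections of hyperplanes as set partitions\<close>

definition block_space :: "nat set set \<Rightarrow> 'a set" where
  "block_space P = {v. \<forall>B\<in>P. \<forall>i\<in>B. \<forall>j\<in>B. v \<bullet> x i = v \<bullet> x j}"

text \<open>The indicator vector of a block. These vectors lie in the subspace of a set partition and
  detect both its blocks and where a permutation sends them.\<close>

definition block_vector :: "nat set \<Rightarrow> 'a" where
  "block_vector B = (\<Sum>i\<in>B. x i)"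

lemma inner_block_vector:
  assumes "B \<subseteq> {1..n}" "j \<in> {1..n}"
  shows "block_vector B \<bullet> x j = (if j \<in> B then 1 else 0)"
proof -
  have "block_vector B \<bullet> x j = (\<Sum>i\<in>B. if i = j then 1 else 0)"
    unfolding block_vector_def inner_sum_left using assms by (intro sum.cong) (auto simp: inner_basis)
  then show ?thesis using finite_subset[OF assms(1)] by simp
qed

lemma block_vector_in_block_space:
  assumes P: "partition_on {1..n} P" and B: "B \<in> P"
  shows "block_vector B \<in> block_space P"
proof -
  have disj: "C = B" if "C \<in> P" "i \<in> C" "i \<in> B" for C i
    using P B that by (auto simp: partition_on_def disjoint_def)
  have sub: "C \<subseteq> {1..n}" if "C \<in> P" for C using P that by (auto simp: partition_on_def)
  show ?thesis unfolding block_space_def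
    using disj sub B by (auto simp: inner_block_vector subset_eq)
qed

text \<open>The subspace determines its set partition: if \<open>j\<close> is outside the block of \<open>i\<close>, the indicator vector
  of that block lies in the subspace and has different coordinates at \<open>i\<close> and \<open>j\<close>.\<close>

lemma same_block_iff:
  assumes P: "partition_on {1..n} P" and i: "i \<in> {1..n}" and j: "j \<in> {1..n}"
  shows "(\<exists>B\<in>P. i \<in> B \<and> j \<in> B) \<longleftrightarrow> (\<forall>v\<in>block_space P. v \<bullet> x i = v \<bullet> x j)"
proof
  assume R: "\<forall>v\<in>block_space P. v \<bullet> x i = v \<bullet> x j"
  obtain B where B: "B \<in> P" "i \<in> B" using partition_onD1[OF P] i by blast
  have "B \<subseteq> {1..n}" using P B by (auto simp: partition_on_def)
  then have "j \<in> B"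
    using R[rule_format, OF block_vector_in_block_space[OF P B(1)]] B(2) i j
    by (simp add: inner_block_vector split: if_splits)
  then show "\<exists>B\<in>P. i \<in> B \<and> j \<in> B" using B by blast
qed (auto simp: block_space_def)

lemma inj_on_block_space: "inj_on block_space {P. partition_on {1..n} P}"
proof -
  have "P \<subseteq> Q" if P: "partition_on {1..n} P" and Q: "partition_on {1..n} Q"
    and eq: "block_space P = block_space Q" for P Q
  proof
    fix B assume B: "B \<in> P"
    then obtain i where i: "i \<in> B" using partition_onD3[OF P] by fastforce
    have sub: "C \<subseteq> {1..n}" if "C \<in> P \<or> C \<in> Q" for C
      using P Q that by (auto simp: partition_on_def)
    have iA: "i \<in> {1..n}" using i B sub by blast
    then obtain C where C: "C \<in> Q" "i \<in> C" using partition_onD1[OF Q] by blast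
    have "j \<in> B \<longleftrightarrow> j \<in> C" if j: "j \<in> {1..n}" for j
    proof -
      have "(\<exists>B\<in>P. i \<in> B \<and> j \<in> B) \<longleftrightarrow> j \<in> B"
        using P B i by (auto simp: partition_on_def disjoint_def)
      moreover have "(\<exists>C\<in>Q. i \<in> C \<and> j \<in> C) \<longleftrightarrow> j \<in> C"
        using Q C by (auto simp: partition_on_def disjoint_def)
      ultimately show ?thesis
        using same_block_iff[OF P iA j] same_block_iff[OF Q iA j] eq by simp
    qed
    then have "B = C" using sub B C by blast
    then show "B \<in> Q" using C by simp
  qed
  then show ?thesis by (intro inj_onI) (simp add: subset_antisym)
qed

lemma hyperplane_eq: "orthogonal_comp {x i - x j} = {v. v \<bullet> x i = v \<bullet> x j}"
  by (auto simp: orthogonal_comp_def orthogonal_def inner_diff_left inner_diff_right inner_commute)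

text \<open>For an intersection \<open>X\<close>, the relation that two coordinates agree on all of \<open>X\<close> is an equivalence
  relation, and its classes are the blocks. Conversely, the subspace of \<open>P\<close> is cut out by the
  hyperplanes for pairs of indices in a common block.\<close>

lemma intersections_arrangement_A_eq:
  "intersections (arrangement_A n x) = block_space ` {P. partition_on {1..n} P}"
proof (intro equalityI subsetI)
  fix X assume "X \<in> intersections (arrangement_A n x)"
  then obtain \<B> where \<B>: "\<B> \<subseteq> arrangement_A n x" and X: "X = \<Inter>\<B>"
    by (auto simp: intersections_def)
  define R where "R = {(i, j). i \<in> {1..n} \<and> j \<in> {1..n} \<and> (\<forall>v\<in>X. v \<bullet> x i = v \<bullet> x j)}"
  have eqR: "equiv {1..n} R"
    by (rule equivI) (auto simp: R_def refl_on_def sym_def trans_def)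
  let ?P = "{1..n} // R"
  have P: "partition_on {1..n} ?P" using eqR by (rule partition_on_quotient)
  have "block_space ?P = {v. \<forall>(i, j)\<in>R. v \<bullet> x i = v \<bullet> x j}" (is "_ = ?V")
  proof (intro equalityI subsetI)
    fix v assume v: "v \<in> block_space ?P"
    show "v \<in> ?V"
    proof clarify
      fix i j assume ij: "(i, j) \<in> R"
      then have "R `` {i} \<in> ?P" "i \<in> R `` {i}" "j \<in> R `` {i}"
        using eqR by (auto simp: R_def quotient_def)
      then show "v \<bullet> x i = v \<bullet> x j" using v unfolding block_space_def by blast
    qed
  next
    fix v assume "v \<in> ?V"
    then show "v \<in> block_space ?P"
      unfolding block_space_def using in_quotient_imp_in_rel[OF eqR] by blast
  qed
  moreover have "?V = X"
  proof (intro equalityI subsetI)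
    fix v assume v: "v \<in> ?V"
    have "v \<in> H" if H: "H \<in> \<B>" for H
    proof -
      obtain i j where ij: "1 \<le> i" "i < j" "j \<le> n" and Hij: "H = orthogonal_comp {x i - x j}"
        using H \<B> by (auto simp: arrangement_A_def)
      have "(i, j) \<in> R" using ij H X by (auto simp: R_def Hij hyperplane_eq)
      then show ?thesis using v by (auto simp: Hij hyperplane_eq)
    qed
    then show "v \<in> X" using X by blast
  qed (auto simp: R_def)
  ultimately show "X \<in> block_space ` {P. partition_on {1..n} P}" using P by blast
next
  fix X assume "X \<in> block_space ` {P. partition_on {1..n} P}"
  then obtain P where P: "partition_on {1..n} P" and X: "X = block_space P" by blast
  let ?\<B> = "{orthogonal_comp {x i - x j} | i j. i < j \<and> (\<exists>B\<in>P. i \<in> B \<and> j \<in> B)}"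
  have sub: "B \<subseteq> {1..n}" if "B \<in> P" for B using P that by (auto simp: partition_on_def)
  have "?\<B> \<subseteq> arrangement_A n x"
    unfolding arrangement_A_def using sub by fastforce
  moreover have "\<Inter>?\<B> = X"
  proof (intro equalityI subsetI)
    fix v assume v: "v \<in> \<Inter>?\<B>"
    have lt: "v \<bullet> x i = v \<bullet> x j" if "B \<in> P" "i \<in> B" "j \<in> B" "i < j" for B i j
    proof -
      have "orthogonal_comp {x i - x j} \<in> ?\<B>" using that by blast
      then show ?thesis using v hyperplane_eq by blast
    qed
    have "v \<bullet> x i = v \<bullet> x j" if "B \<in> P" "i \<in> B" "j \<in> B" for B i j
      using lt[OF that] lt[OF that(1,3,2)] by (metis linorder_less_linear)
    then show "v \<in> X" unfolding X block_space_def by blast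
  next
    fix v assume "v \<in> X"
    then show "v \<in> \<Inter>?\<B>" by (auto simp: X block_space_def hyperplane_eq)
  qed
  ultimately show "X \<in> intersections (arrangement_A n x)"
    unfolding intersections_def by blast
qed

section \<open>The order of the arrangement monoid\<close>

lemma dom_partial_restriction: "dom (partial_restriction g X) = X"
  by (simp add: partial_restriction_def dom_def restrict_map_def)

lemma partial_restriction_eq_iff:
  "partial_restriction g X = partial_restriction h X \<longleftrightarrow> (\<forall>v\<in>X. g v = h v)"
  by (auto simp: partial_restriction_def restrict_map_def fun_eq_iff)

lemma inner_permute_block_vector:
  assumes p: "p permutes {1..n}" and B: "B \<subseteq> {1..n}" and j: "j \<in> {1..n}"
  shows "L p (block_vector B) \<bullet> x j = (if j \<in> p ` B then 1 else 0)"
proof -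
  obtain i where i: "i \<in> {1..n}" "j = p i" using j permutes_image[OF p] by blast
  then show ?thesis
    using permutes_inj[OF p] by (simp add: inner_permute_coordinates[OF p] inner_block_vector[OF B] inj_image_mem_iff)
qed

text \<open>The image of the indicator vector of \<open>B\<close> under \<open>L p\<close> is that of \<open>p ` B\<close>, so equal restrictions
  give equal images of the blocks. Conversely, if
  \<open>p ` B = q ` B\<close>, the coordinate at \<open>p i\<close> of either image of \<open>v\<close> is a coordinate of \<open>v\<close> at some index in
  the block of \<open>i\<close>, and \<open>v\<close> is constant there.\<close>

lemma restriction_eq_iff_block_images_eq:
  assumes P: "partition_on {1..n} P" and p: "p permutes {1..n}" and q: "q permutes {1..n}"
  shows "partial_restriction (L p) (block_space P) = partial_restriction (L q) (block_space P)
    \<longleftrightarrow> (\<forall>B\<in>P. p ` B = q ` B)"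
proof -
  have sub: "B \<subseteq> {1..n}" if "B \<in> P" for B using P that by (auto simp: partition_on_def)
  have images: "p ` B = q ` B" if eq: "\<forall>v\<in>block_space P. L p v = L q v" and B: "B \<in> P" for B
  proof -
    have "j \<in> p ` B \<longleftrightarrow> j \<in> q ` B" if j: "j \<in> {1..n}" for j
      using eq block_vector_in_block_space[OF P B]
        inner_permute_block_vector[OF p sub[OF B] j] inner_permute_block_vector[OF q sub[OF B] j]
      by (metis zero_neq_one)
    moreover have "p ` B \<subseteq> {1..n}" "q ` B \<subseteq> {1..n}"
      using sub[OF B] permutes_image[OF p] permutes_image[OF q] by blast+
    ultimately show ?thesis by blast
  qed
  have maps: "L p v = L q v" if eq: "\<forall>B\<in>P. p ` B = q ` B" and v: "v \<in> block_space P" for v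
    unfolding permute_coordinates_eq_iff[OF p]
  proof
    fix i assume i: "i \<in> {1..n}"
    then obtain B where B: "B \<in> P" "i \<in> B" using partition_onD1[OF P] by blast
    then obtain k where k: "k \<in> B" "p i = q k" using eq by blast
    then have "L q v \<bullet> x (p i) = v \<bullet> x k"
      using inner_permute_coordinates[OF q] sub[OF B(1)] by auto
    also have "\<dots> = v \<bullet> x i" using v B k(1) unfolding block_space_def by blast
    finally show "L q v \<bullet> x (p i) = v \<bullet> x i" .
  qed
  show ?thesis unfolding partial_restriction_eq_iff
    by (rule iffI) (rule ballI, erule (1) images maps)+
qed

text \<open>The monoid splits according to the domains of its elements. Each domain is the subspace of
  exactly one set partition \<open>P\<close>, and the elements with this domain are the cosets of the
  stabilizer of the blocks of \<open>P\<close>.\<close>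

lemma order_arrangement_monoid_A:
  "real (order (arrangement_monoid (weyl_group_A n x) (intersections (arrangement_A n x)))) =
    (\<Sum>P | partition_on {1..n} P. fact n / real (\<Prod>k\<in>#block_sizes P. fact k))"
proof -
  let ?S = "{P. partition_on {1..n} P}"
  let ?F = "\<lambda>P p. partial_restriction (L p) (block_space P)"
  let ?C = "\<lambda>P. ?F P ` {p. p permutes {1..n}}"
  have finS: "finite ?S" by (rule finitely_many_partition_on) simp
  have "carrier (arrangement_monoid (weyl_group_A n x) (intersections (arrangement_A n x))) = (\<Union>P\<in>?S. ?C P)"
    by (auto simp: arrangement_monoid_def weyl_group_A_eq intersections_arrangement_A_eq)
  moreover have "card (\<Union>P\<in>?S. ?C P) = (\<Sum>P\<in>?S. card (?C P))"
  proof (rule card_UN_disjoint[OF finS])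
    show "\<forall>P\<in>?S. finite (?C P)" by (simp add: finite_permutations)
    have "P = Q" if "P \<in> ?S" "Q \<in> ?S" "?F P p = ?F Q q" for P Q p q
      using that(1,2) arg_cong[OF that(3), of dom] inj_on_block_space
      by (simp add: dom_partial_restriction inj_on_def)
    then show "\<forall>P\<in>?S. \<forall>Q\<in>?S. P \<noteq> Q \<longrightarrow> ?C P \<inter> ?C Q = {}" by blast
  qed
  moreover have "real (card (?C P)) = fact n / real (\<Prod>k\<in>#block_sizes P. fact k)" if "P \<in> ?S" for P
  proof -
    have P: "partition_on {1..n} P" using that by simp
    have "card (?C P) * (\<Prod>B\<in>P. fact (card B)) = fact (card {1..n})"
      by (rule card_permutations_mod_blocks[OF finite_atLeastAtMost P restriction_eq_iff_block_images_eq[OF P]])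
    moreover have "(\<Prod>B\<in>P. fact (card B)) = (\<Prod>k\<in>#block_sizes P. fact k :: nat)"
      by (simp add: block_sizes_def prod_unfold_prod_mset image_mset.compositionality comp_def)
    ultimately have "card (?C P) * (\<Prod>k\<in>#block_sizes P. fact k) = fact n" by simp
    then have "real (card (?C P)) * real (\<Prod>k\<in>#block_sizes P. fact k) = fact n"
      by (metis of_nat_fact of_nat_mult)
    moreover have "real (\<Prod>k\<in>#block_sizes P. fact k) \<noteq> 0" by (auto simp: prod_mset_zero_iff)
    ultimately show ?thesis by (simp add: field_simps)
  qed
  ultimately show ?thesis by (simp add: order_def)
qed

end

theorem theorem4:
  fixes n :: nat and x :: "nat \<Rightarrow> 'a::euclidean_space"
  assumes "n \<ge> 2" and "orthonormal_basis n x"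
  shows "real (order (arrangement_monoid (weyl_group_A n x) (intersections (arrangement_A n x)))) =
    (fact n)\<^sup>2 * (\<Sum>l | is_partition n l. 1 / (real (b_coeff l) * (\<Prod>k\<leftarrow>l. fact k)))"
proof -
  let ?N = "\<lambda>l. card {P. partition_on {1..n} P \<and> block_sizes P = mset l}"
  let ?fac = "\<lambda>M. real (\<Prod>k\<in>#M. fact k)"
  have "real (order (arrangement_monoid (weyl_group_A n x) (intersections (arrangement_A n x)))) =
      (\<Sum>P | partition_on {1..n} P. fact n / ?fac (block_sizes P))"
    using assms(2) by (rule order_arrangement_monoid_A)
  also have "\<dots> = (\<Sum>l | is_partition n l. real (?N l) * (fact n / ?fac (mset l)))"
    using sum_over_set_partitions_by_type[of "{1..n}" "\<lambda>M. fact n / ?fac M"] by simp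
  also have "\<dots> = (\<Sum>l | is_partition n l. (fact n)\<^sup>2 * (1 / (real (b_coeff l) * (\<Prod>k\<leftarrow>l. fact k))))"
  proof (rule sum.cong[OF refl])
    fix l assume "l \<in> {l. is_partition n l}"
    then have l: "is_partition n l" by simp
    have "set_mset (mset l) \<subseteq> {1..n}" "sum_mset (mset l) = card {1..n}"
      using l member_le_sum_list[of _ l] by (auto simp: is_partition_def sum_mset_sum_list)
    then have "?N l * b_coeff l = fact n"
      using card_partitions_of_type[of "{1..n}" "mset l" n] by (simp add: b_coeff_eq_type_weight[OF l])
    then have "real (?N l) * real (b_coeff l) = fact n" by (metis of_nat_fact of_nat_mult)
    then have "real (?N l) = fact n / real (b_coeff l)"
      by (metis fact_nonzero mult_zero_right nonzero_eq_divide_eq)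
    moreover have "?fac (mset l) = (\<Prod>k\<leftarrow>l. fact k)"
      by (induction l) auto
    ultimately show "real (?N l) * (fact n / ?fac (mset l)) =
        (fact n)\<^sup>2 * (1 / (real (b_coeff l) * (\<Prod>k\<leftarrow>l. fact k)))"
      by (simp add: power2_eq_square)
  qed
  also have "\<dots> = (fact n)\<^sup>2 * (\<Sum>l | is_partition n l. 1 / (real (b_coeff l) * (\<Prod>k\<leftarrow>l. fact k)))"
    by (simp add: sum_distrib_left)
  finally show ?thesis .
qed

end
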